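(* For every $n\in\mathbb{N}$ the following relations hold in $U$: $$[x,x(yyxx)^ny]=(q^2-q^{-2})(xxyy)^nxxy,$$ $$[y(xxyy)^nx,x]=(q^2-q^{-2})yxx(yyxx)^n,$$ $$[x,xyy(xxyy)^nx]=(q^2-q^{-2})\left((xxyy)^{n+1}x-x(yyxx)^{n+1}\right),$$ $$[x,yxx(yyxx)^ny]=0.$$
   Context: Let $\mathbb{F}$ be a field of characteristic zero and let $q\in\mathbb{F}$ be nonzero and not a root of unity; $\mathbb{N}=\{0,1,2,\ldots\}$. Let $\mathbb{V}$ be the free associative unital $\mathbb{F}$-algebra on two noncommuting generators (letters) $x,y$; the words in $x,y$ (including the trivial word $\mathbf{1}$) form a basis of $\mathbb{V}$. Words such as $(xxyy)^nx$ are written with respect to the free (concatenation) product. The $q$-shuffle product $\star$ on the vector space $\mathbb{V}$ is the bilinear associative product with unit $\mathbf{1}$ determined as follows. Put $\langle x,x\rangle=\langle y,y\rangle=2$ and $\langle x,y\rangle=\langle y,x\rangle=-2$. For nontrivial words $u=u_1\cdots u_r$ and $v=v_1\cdots v_s$, $$u\star v=u_1\big((u_2\cdots u_r)\star v\big)+v_1\big(u\star(v_2\cdots v_s)\big)q^{\langle v_1,u_1\rangle+\cdots+\langle v_1,u_r\rangle}.$$ $U$ denotes the subalgebra of $(\mathbb{V},\star)$ generated by $x,y$; all the words in the statement lie in $U$. The commutator is taken with respect to $\star$: $[X,Y]=X\star Y-Y\star X$. *)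

theory Defs
  imports "HOL-Library.Poly_Mapping"
begin

datatype letter = X | Y

text \<open>
  Words form the free monoid on the two letters, written additively because
  \<^typ>\<open>'w \<Rightarrow>\<^sub>0 'a\<close> carries its convolution product for an additive monoid of exponents.
  With this instance the product \<open>*\<close> on finitely supported functions on words is the
  concatenation product, so \<^typ>\<open>letter list \<Rightarrow>\<^sub>0 'a\<close> is the free associative algebra.
\<close>

instantiation list :: (type) monoid_add
begin

definition zero_list :: "'a list" where "0 = []"

definition plus_list :: "'a list \<Rightarrow> 'a list \<Rightarrow> 'a list" where "u + v = u @ v"

instance
  by standard (simp_all add: zero_list_def plus_list_def)

end

type_synonym 'a free_alg = "letter list \<Rightarrow>\<^sub>0 'a"

definition word :: "letter list \<Rightarrow> 'a::field free_alg"
  where "word w = Poly_Mapping.single w 1"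

abbreviation gen_x :: "'a::field free_alg" (\<open>x\<^sub>V\<close>)
  where "x\<^sub>V \<equiv> word [X]"

abbreviation gen_y :: "'a::field free_alg" (\<open>y\<^sub>V\<close>)
  where "y\<^sub>V \<equiv> word [Y]"

definition smult :: "'a::field \<Rightarrow> 'a free_alg \<Rightarrow> 'a free_alg" (infixr \<open>*\<^sub>V\<close> 75)
  where "c *\<^sub>V f = Poly_Mapping.map ((*) c) f"

lemma lookup_smult [simp]: "Poly_Mapping.lookup (c *\<^sub>V f) w = c * Poly_Mapping.lookup f w"
  by (simp add: smult_def Poly_Mapping.map.rep_eq when_def)

lemma word_Nil: "word [] = 1"
  by (simp add: word_def flip: zero_list_def)

lemma word_append: "word (u @ v) = word u * word v"
  by (simp add: word_def mult_single flip: plus_list_def)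

definition letter_form :: "letter \<Rightarrow> letter \<Rightarrow> int"
  where "letter_form a b = (if a = b then 2 else - 2)"

fun qshuffle_word :: "'a::field \<Rightarrow> letter list \<Rightarrow> letter list \<Rightarrow> 'a free_alg" where
  "qshuffle_word q [] v = word v"
| "qshuffle_word q u [] = word u"
| "qshuffle_word q (a # u) (b # v) =
     word [a] * qshuffle_word q u (b # v)
     + (q powi (\<Sum>c\<leftarrow>a # u. letter_form b c)) *\<^sub>V (word [b] * qshuffle_word q (a # u) v)"

definition qshuffle :: "'a::field \<Rightarrow> 'a free_alg \<Rightarrow> 'a free_alg \<Rightarrow> 'a free_alg"
  where "qshuffle q f g =
    (\<Sum>u\<in>Poly_Mapping.keys f. \<Sum>v\<in>Poly_Mapping.keys g.
      (Poly_Mapping.lookup f u * Poly_Mapping.lookup g v) *\<^sub>V qshuffle_word q u v)"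

lemma qshuffle_word_word: "qshuffle q (word u) (word v) = qshuffle_word q u v"
  by (rule poly_mapping_eqI) (simp add: qshuffle_def word_def)

definition qcomm :: "'a::field \<Rightarrow> 'a free_alg \<Rightarrow> 'a free_alg \<Rightarrow> 'a free_alg"
  where "qcomm q f g = qshuffle q f g - qshuffle q g f"

end

theory Submission
  imports Defs
begin

text \<open>
  For an integer \<open>k\<close> and a word \<open>w\<close> put \<open>F k w = q\<^sup>k (x \<star> w) - w \<star> x\<close>, so that \<open>F 0 w\<close> is the
  commutator \<open>[x, w]\<close>. Unlike the commutator itself, \<open>F\<close> satisfies a closed recursion along the
  word: \<open>F k (b w) = b F (k + \<langle>x, b\<rangle>) w + (q\<^sup>k - q\<^bsup>\<langle>x, b w\<rangle>\<^esup>) x b w\<close>. The blocks \<open>xxyy\<close> and \<open>yyxx\<close>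
  have total weight zero, so stripping one of them leaves \<open>k\<close> unchanged, and the extra terms
  telescope.
\<close>

lemma smult_zero_left [simp]: "0 *\<^sub>V f = 0"
  by (rule poly_mapping_eqI) simp

lemma smult_one [simp]: "1 *\<^sub>V f = f"
  by (rule poly_mapping_eqI) simp

lemma smult_smult [simp]: "c *\<^sub>V d *\<^sub>V f = (c * d) *\<^sub>V f"
  by (rule poly_mapping_eqI) (simp add: mult.assoc)

lemma smult_add_right: "c *\<^sub>V (f + g) = c *\<^sub>V f + c *\<^sub>V g"
  by (rule poly_mapping_eqI) (simp add: lookup_add distrib_left)

lemma smult_diff_right: "c *\<^sub>V (f - g) = c *\<^sub>V f - c *\<^sub>V g"
  by (rule poly_mapping_eqI) (simp add: lookup_minus right_diff_distrib)

lemma smult_diff_left: "(c - d) *\<^sub>V f = c *\<^sub>V f - d *\<^sub>V f"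
  by (rule poly_mapping_eqI) (simp add: lookup_minus left_diff_distrib)

text \<open>Scaling by \<open>c\<close> is left multiplication by \<open>single 0 c\<close>, with
  \<open>0\<close> the empty word, and this element commutes with every word.\<close>

lemma word_mult_smult: "word u * (c *\<^sub>V f) = c *\<^sub>V (word u * f)"
proof -
  have "word u * Poly_Mapping.single 0 c = Poly_Mapping.single 0 c * word u"
    by (simp add: word_def mult_single)
  then show ?thesis
    by (metis mult.assoc mult_map_scale_conv_mult smult_def)
qed

lemma word_Cons: "word (a # w) = word [a] * word w"
  using word_append[of "[a]" w] by simp

lemma word_concat_replicate: "word (concat (replicate n u)) = word u ^ n"
  by (induction n) (simp_all add: word_Nil word_append)

text \<open>The exponent of \<open>q\<close> that \<open>x\<close> collects in
  \<open>w \<star> x\<close> by moving in front of all of \<open>w\<close>.\<close>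

abbreviation weight :: "letter list \<Rightarrow> int"
  where "weight w \<equiv> \<Sum>c\<leftarrow>w. letter_form X c"

lemma qshuffle_word_Nil_right [simp]: "qshuffle_word q w [] = word w"
  by (cases w) simp_all

lemma letter_form_commute: "letter_form a b = letter_form b a"
  by (simp add: letter_form_def)

definition twisted_comm :: "'a::field \<Rightarrow> int \<Rightarrow> letter list \<Rightarrow> 'a free_alg"
  where "twisted_comm q k w = q powi k *\<^sub>V qshuffle_word q [X] w - qshuffle_word q w [X]"

lemma qcomm_x_word: "qcomm q x\<^sub>V (word w) = twisted_comm q 0 w"
  by (simp add: qcomm_def twisted_comm_def qshuffle_word_word)

lemma qcomm_word_x: "qcomm q (word w) x\<^sub>V = - twisted_comm q 0 w"
  by (simp add: qcomm_def twisted_comm_def qshuffle_word_word)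

lemma twisted_comm_Nil: "twisted_comm q k [] = (q powi k - 1) *\<^sub>V x\<^sub>V"
  by (simp add: twisted_comm_def smult_diff_left)

text \<open>Sort both products by the letter put first. If it is \<open>b\<close>, the factor from
  \<open>x \<star> b w\<close> merges with the twist, as \<open>q\<close> is invertible; if it is
  the inserted \<open>x\<close>, only the word \<open>x b w\<close> arises, with coefficients
  \<open>q powi k\<close> and \<open>q powi weight (b # w)\<close>.\<close>

lemma twisted_comm_Cons:
  assumes "q \<noteq> 0"
  shows "twisted_comm q k (b # w) =
     word [b] * twisted_comm q (k + letter_form X b) w
     + (q powi k - q powi weight (b # w)) *\<^sub>V (x\<^sub>V * word (b # w))"
  using assms
  by (simp add: twisted_comm_def smult_add_right smult_diff_left power_int_add
      word_mult_smult letter_form_commute[of _ X] algebra_simps)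

text \<open>Write \<open>d = q powi 2 - q powi (- 2)\<close>. The twist runs through 2, 0, -2, 0, 2;
  at twist 0 the remaining weight is 0, so only \<open>d xyyxxw - d yyxxxw\<close> is added. The
  second term cancels the leading term of the hypothesis. The remainder \<open>r\<close> lets one
  induction serve different end words.\<close>

lemma twisted_comm_yyxx:
  assumes q: "q \<noteq> 0" and w: "weight w = - 2"
    and IH: "twisted_comm q 2 w = (q powi 2 - q powi (- 2)) *\<^sub>V word (X # w) - r"
  shows "twisted_comm q 2 ([Y, Y, X, X] @ w) =
    (q powi 2 - q powi (- 2)) *\<^sub>V word (X # [Y, Y, X, X] @ w) - word [Y, Y, X, X] * r"
  using w
  by (simp add: twisted_comm_Cons[OF q] IH letter_form_def word_Cons[of _ "_ # _"]
      word_Cons[of _ w] word_mult_smult right_diff_distrib distrib_left mult.assoc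
      smult_diff_left del: power_int_numeral)

text \<open>The twist runs through -2, 0, 2, 0, -2. The surviving extra terms are multiples of the
  same word \<open>xxxyyw\<close> with opposite coefficients, so no remainder arises.\<close>

lemma twisted_comm_xxyy:
  assumes q: "q \<noteq> 0" and w: "weight w = 2"
  shows "twisted_comm q (- 2) ([X, X, Y, Y] @ w) = word [X, X, Y, Y] * twisted_comm q (- 2) w"
  using w
  by (simp add: twisted_comm_Cons[OF q] letter_form_def word_Cons[of _ "_ # _"]
      word_Cons[of _ w] word_mult_smult right_diff_distrib distrib_left mult.assoc
      smult_diff_left del: power_int_numeral)

lemma weight_concat_replicate: "weight (concat (replicate n u)) = int n * weight u"
  by (induction n) (simp_all add: algebra_simps)

lemma twisted_comm_yyxx_power:
  assumes "q \<noteq> 0" and w: "weight w = - 2"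
    and "twisted_comm q 2 w = (q powi 2 - q powi (- 2)) *\<^sub>V word (X # w) - r"
  shows "twisted_comm q 2 (concat (replicate n [Y, Y, X, X]) @ w) =
    (q powi 2 - q powi (- 2)) *\<^sub>V word (X # concat (replicate n [Y, Y, X, X]) @ w)
    - word (concat (replicate n [Y, Y, X, X])) * r"
proof (induction n)
  case 0
  show ?case
    using assms(3) by (simp add: word_Nil)
next
  case (Suc n)
  have "weight (concat (replicate n [Y, Y, X, X]) @ w) = - 2"
    using w by (simp only: map_append sum_list_append weight_concat_replicate)
      (simp add: letter_form_def)
  from twisted_comm_yyxx[OF assms(1) this Suc] show ?case
    by (simp add: word_append[of "[Y, Y, X, X]" "concat (replicate n [Y, Y, X, X])", simplified]
        mult.assoc del: power_int_numeral)
qed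

lemma twisted_comm_xxyy_power:
  assumes "q \<noteq> 0" and w: "weight w = 2"
  shows "twisted_comm q (- 2) (concat (replicate n [X, X, Y, Y]) @ w) =
    word (concat (replicate n [X, X, Y, Y])) * twisted_comm q (- 2) w"
proof (induction n)
  case 0
  show ?case
    by (simp add: word_Nil)
next
  case (Suc n)
  have "weight (concat (replicate n [X, X, Y, Y]) @ w) = 2"
    using w by (simp only: map_append sum_list_append weight_concat_replicate)
      (simp add: letter_form_def)
  from twisted_comm_xxyy[OF assms(1) this] Suc show ?case
    by (simp add: word_append[of "[X, X, Y, Y]" "concat (replicate n [X, X, Y, Y])", simplified]
        mult.assoc)
qed

lemma mult_power_shift: "a * (b * a) ^ n = (a * b) ^ n * a" for a b :: "'a::monoid_mult"
  by (induction n) (simp_all add: mult.assoc)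

lemma mult_power_shift_left: "a * ((b * a) ^ n * c) = (a * b) ^ n * (a * c)"
  for a b c :: "'a::monoid_mult"
  by (metis mult.assoc mult_power_shift)

theorem proposition4p7:
  fixes q :: "'a::field_char_0" and n :: nat
  assumes "q \<noteq> 0"
    and "\<And>m::nat. m > 0 \<Longrightarrow> q ^ m \<noteq> 1"
  shows
    "qcomm q x\<^sub>V (x\<^sub>V * (y\<^sub>V * y\<^sub>V * x\<^sub>V * x\<^sub>V) ^ n * y\<^sub>V)
       = (q powi 2 - q powi (- 2)) *\<^sub>V ((x\<^sub>V * x\<^sub>V * y\<^sub>V * y\<^sub>V) ^ n * x\<^sub>V * x\<^sub>V * y\<^sub>V)
     \<and> qcomm q (y\<^sub>V * (x\<^sub>V * x\<^sub>V * y\<^sub>V * y\<^sub>V) ^ n * x\<^sub>V) x\<^sub>V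
       = (q powi 2 - q powi (- 2)) *\<^sub>V (y\<^sub>V * x\<^sub>V * x\<^sub>V * (y\<^sub>V * y\<^sub>V * x\<^sub>V * x\<^sub>V) ^ n)
     \<and> qcomm q x\<^sub>V (x\<^sub>V * y\<^sub>V * y\<^sub>V * (x\<^sub>V * x\<^sub>V * y\<^sub>V * y\<^sub>V) ^ n * x\<^sub>V)
       = (q powi 2 - q powi (- 2)) *\<^sub>V
           ((x\<^sub>V * x\<^sub>V * y\<^sub>V * y\<^sub>V) ^ (n + 1) * x\<^sub>V - x\<^sub>V * (y\<^sub>V * y\<^sub>V * x\<^sub>V * x\<^sub>V) ^ (n + 1))
     \<and> qcomm q x\<^sub>V (y\<^sub>V * x\<^sub>V * x\<^sub>V * (y\<^sub>V * y\<^sub>V * x\<^sub>V * x\<^sub>V) ^ n * y\<^sub>V) = 0"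
proof -
  let ?d = "q powi 2 - q powi (- 2)"
  let ?A = "concat (replicate n [Y, Y, X, X])" and ?B = "concat (replicate n [X, X, Y, Y])"
  note Cons = twisted_comm_Cons[OF \<open>q \<noteq> 0\<close>]
  note words = word_append word_Cons[of _ "_ # _"] word_Cons[of _ "_ @ _"]
    word_concat_replicate mult.assoc
  \<comment> \<open>Once \<open>words\<close> has turned \<open>word ?A\<close> and
    \<open>word ?B\<close> into powers, scalars must be pulled past these powers as well.\<close>
  note smults = word_mult_smult word_mult_smult[of ?A, unfolded words]
    word_mult_smult[of ?B, unfolded words]
  \<comment> \<open>These pass between powers of \<open>yyxx\<close> and of \<open>xxyy\<close>, in
    right-nested form.\<close>
  note shift =
    mult_power_shift[of "x\<^sub>V * x\<^sub>V" "y\<^sub>V * y\<^sub>V", unfolded mult.assoc]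
    mult_power_shift_left[of "x\<^sub>V * x\<^sub>V" "y\<^sub>V * y\<^sub>V", unfolded mult.assoc]
    mult_power_shift_left[of "y\<^sub>V * y\<^sub>V" "x\<^sub>V * x\<^sub>V", unfolded mult.assoc]
  have A: "weight ?A = 0" and B: "weight ?B = 0"
    by (simp_all only: weight_concat_replicate) (simp_all add: letter_form_def)
  \<comment> \<open>Remainder 0: after the final \<open>y\<close> the twist is 0, and it vanishes on
    the empty word.\<close>
  have Ay: "twisted_comm q 2 (?A @ [Y]) = ?d *\<^sub>V word ([X] @ ?A @ [Y])"
    using twisted_comm_yyxx_power[OF \<open>q \<noteq> 0\<close>, of "[Y]" 0 n]
    by (simp add: Cons twisted_comm_Nil letter_form_def word_Cons[of _ "_ # _"]
        del: power_int_numeral)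
  \<comment> \<open>The remainder comes from the last \<open>x\<close>, met at twist -2, which
    contributes \<open>- d xx\<close> behind \<open>yy\<close>.\<close>
  have Ayyx: "twisted_comm q 2 (?A @ [Y, Y, X]) =
      ?d *\<^sub>V word ([X] @ ?A @ [Y, Y, X]) - ?d *\<^sub>V word (?A @ [Y, Y, X, X])"
    using twisted_comm_yyxx_power[OF \<open>q \<noteq> 0\<close>, of "[Y, Y, X]" "?d *\<^sub>V word [Y, Y, X, X]" n]
    by (simp add: Cons twisted_comm_Nil letter_form_def words smults smult_diff_left
        right_diff_distrib del: power_int_numeral)
  have Bx: "twisted_comm q (- 2) (?B @ [X]) = - (?d *\<^sub>V word (?B @ [X, X]))"
    using twisted_comm_xxyy_power[OF \<open>q \<noteq> 0\<close>, of "[X]" n]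
    by (simp add: Cons twisted_comm_Nil letter_form_def words smults smult_diff_left
        right_diff_distrib del: power_int_numeral)
  \<comment> \<open>The whole word has weight 0, so the first letter adds no extra term and only
    changes the twist; likewise in \<open>2\<close> and \<open>3\<close>.\<close>
  have 1: "qcomm q x\<^sub>V (word ([X] @ ?A @ [Y])) = ?d *\<^sub>V word ([X, X] @ ?A @ [Y])"
    unfolding qcomm_x_word using Ay A
    by (simp add: Cons letter_form_def words word_mult_smult del: power_int_numeral)
  have 2: "qcomm q (word ([Y] @ ?B @ [X])) x\<^sub>V = ?d *\<^sub>V word ([Y] @ ?B @ [X, X])"
    unfolding qcomm_word_x using Bx B
    by (simp add: Cons letter_form_def words word_mult_smult del: power_int_numeral)
  \<comment> \<open>The word \<open>xyy(xxyy)^n x\<close> regrouped, so that the blocks are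
    \<open>yyxx\<close>.\<close>
  have 3: "qcomm q x\<^sub>V (word ([X] @ ?A @ [Y, Y, X])) =
      ?d *\<^sub>V (word ([X, X] @ ?A @ [Y, Y, X]) - word ([X] @ ?A @ [Y, Y, X, X]))"
    unfolding qcomm_x_word using Ayyx A
    by (simp add: Cons letter_form_def words word_mult_smult smult_diff_right
        right_diff_distrib del: power_int_numeral)
  \<comment> \<open>The first \<open>x\<close> is met at twist -2 and adds \<open>-d\<close> times
    the word that \<open>Ay\<close> yields with coefficient \<open>d\<close>.\<close>
  have 4: "qcomm q x\<^sub>V (word ([Y, X, X] @ ?A @ [Y])) = 0"
    unfolding qcomm_x_word using Ay A
    by (simp add: Cons letter_form_def words word_mult_smult smult_diff_left
        right_diff_distrib distrib_left del: power_int_numeral)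
  from 1 2 3 4 show ?thesis
    by (simp add: words shift del: power_int_numeral)
qed

end
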